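(* The Houghton groups $H_n$ are not co-Hopfian, and are in fact dis-co-Hopfian.
   Context: For $n\ge 1$, the Houghton group $H_n$ is the group of permutations of $\{1,\dots,n\}\times\mathbb{N}$ that are eventual translations, i.e. for each ray $\{i\}\times\mathbb{N}$ there is $t_i\in\mathbb{Z}$ such that $(i,x)\mapsto(i,x+t_i)$ for all but finitely many $x$. A group $G$ is co-Hopfian if every injective homomorphism $G\to G$ is surjective. $G$ is *dis-co-Hopfian* if there is an injective homomorphism $\eta:G\to G$ with $\bigcap_{k=1}^\infty \eta^k(G)=\{e\}$. *)

theory Defs
  imports "HOL-Algebra.Algebra"
begin

definition co_hopfian :: "('a, 'b) monoid_scheme \<Rightarrow> bool" where
  "co_hopfian G \<longleftrightarrow> (\<forall>\<phi> \<in> mon G G. \<phi> ` carrier G = carrier G)"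

definition dis_co_hopfian :: "('a, 'b) monoid_scheme \<Rightarrow> bool" where
  "dis_co_hopfian G \<longleftrightarrow> (\<exists>\<eta> \<in> mon G G. (\<Inter>k\<in>{1..}. (\<eta> ^^ k) ` carrier G) = {\<one>\<^bsub>G\<^esub>})"

definition rays :: "nat \<Rightarrow> (nat \<times> nat) set" where
  "rays n = {1..n} \<times> UNIV"

(* As int (snd (f (i, x))) = int x + t is an equation between integers, no truncation occurs;
   for negative t it can hold only when x + t is nonnegative. *)
definition eventual_translation :: "nat \<Rightarrow> (nat \<times> nat \<Rightarrow> nat \<times> nat) \<Rightarrow> bool" where
  "eventual_translation n f \<longleftrightarrow>
    (\<forall>i \<in> {1..n}. \<exists>t::int. \<forall>\<^sub>F x in cofinite. fst (f (i, x)) = i \<and> int (snd (f (i, x))) = int x + t)"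

(* Multiplication, inherited from BijGroup, is composition of permutations of rays n,
   each represented by a function that is undefined outside rays n. *)
definition houghton :: "nat \<Rightarrow> (nat \<times> nat \<Rightarrow> nat \<times> nat) monoid" where
  "houghton n = (BijGroup (rays n)) \<lparr>carrier := {f \<in> Bij (rays n). eventual_translation n f}\<rparr>"

lemma eventual_translation_compose:
  assumes f: "eventual_translation n f" and g: "eventual_translation n g"
  shows "eventual_translation n (compose (rays n) f g)"
  unfolding eventual_translation_def cofinite_eq_sequentially eventually_sequentially
proof
  fix i assume i: "i \<in> {1..n}"
  obtain s M where M: "\<And>x. x \<ge> M \<Longrightarrow> fst (f (i, x)) = i \<and> int (snd (f (i, x))) = int x + s"
    using f i unfolding eventual_translation_def cofinite_eq_sequentially eventually_sequentially
    by meson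
  obtain t N where N: "\<And>x. x \<ge> N \<Longrightarrow> fst (g (i, x)) = i \<and> int (snd (g (i, x))) = int x + t"
    using g i unfolding eventual_translation_def cofinite_eq_sequentially eventually_sequentially
    by meson
  have "fst (compose (rays n) f g (i, x)) = i \<and>
        int (snd (compose (rays n) f g (i, x))) = int x + (s + t)"
    if x: "x \<ge> N + M + nat \<bar>t\<bar>" for x
  proof -
    have "x \<ge> N" using x by simp
    then have g1: "fst (g (i, x)) = i" and g2: "int (snd (g (i, x))) = int x + t"
      using N by auto
    have g3: "g (i, x) = (i, snd (g (i, x)))" using g1 by (metis prod.collapse)
    have "M \<le> snd (g (i, x))" using g2 x by linarith
    from M[OF this] have "fst (f (g (i, x))) = i \<and> int (snd (f (g (i, x)))) = int x + t + s"
      using g2 g3 by simp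
    then show ?thesis using i by (simp add: compose_def rays_def)
  qed
  then show "\<exists>u N. \<forall>x\<ge>N. fst (compose (rays n) f g (i, x)) = i \<and>
      int (snd (compose (rays n) f g (i, x))) = int x + u"
    by blast
qed

lemma eventual_translation_inv:
  assumes f: "eventual_translation n f" and b: "f \<in> Bij (rays n)"
  shows "eventual_translation n (\<lambda>p\<in>rays n. inv_into (rays n) f p)"
  unfolding eventual_translation_def cofinite_eq_sequentially eventually_sequentially
proof
  fix i assume i: "i \<in> {1..n}"
  obtain s M where M: "\<And>x. x \<ge> M \<Longrightarrow> fst (f (i, x)) = i \<and> int (snd (f (i, x))) = int x + s"
    using f i unfolding eventual_translation_def cofinite_eq_sequentially eventually_sequentially
    by meson
  have inj: "inj_on f (rays n)" using b by (simp add: Bij_def bij_betw_def)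
  have "fst ((\<lambda>p\<in>rays n. inv_into (rays n) f p) (i, x)) = i \<and>
        int (snd ((\<lambda>p\<in>rays n. inv_into (rays n) f p) (i, x))) = int x + - s"
    if x: "x \<ge> M + nat \<bar>s\<bar>" for x
  proof -
    define y where "y = nat (int x - s)"
    have y: "int y = int x - s" "M \<le> y" using x by (auto simp: y_def)
    then have "f (i, y) = (i, x)" using M[OF y(2)] by (simp add: prod_eq_iff)
    then have "inv_into (rays n) f (i, x) = (i, y)"
      using inj i by (metis inv_into_f_f mem_Sigma_iff rays_def UNIV_I)
    then show ?thesis using i y by (simp add: rays_def)
  qed
  then show "\<exists>u N. \<forall>x\<ge>N. fst ((\<lambda>p\<in>rays n. inv_into (rays n) f p) (i, x)) = i \<and>
      int (snd ((\<lambda>p\<in>rays n. inv_into (rays n) f p) (i, x))) = int x + u"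
    by blast
qed

lemma eventual_translation_id: "eventual_translation n (\<lambda>p\<in>rays n. p)"
  unfolding eventual_translation_def
proof
  fix i assume "i \<in> {1..n}"
  then show "\<exists>t. \<forall>\<^sub>F x in cofinite. fst ((\<lambda>p\<in>rays n. p) (i, x)) = i \<and>
      int (snd ((\<lambda>p\<in>rays n. p) (i, x))) = int x + t"
    by (intro exI[of _ 0]) (simp add: rays_def)
qed

lemma subgroup_houghton:
  "subgroup {f \<in> Bij (rays n). eventual_translation n f} (BijGroup (rays n))"
proof
  show "{f \<in> Bij (rays n). eventual_translation n f} \<subseteq> carrier (BijGroup (rays n))"
    by (auto simp: BijGroup_def)
next
  fix f g
  assume "f \<in> {f \<in> Bij (rays n). eventual_translation n f}"
    and "g \<in> {f \<in> Bij (rays n). eventual_translation n f}"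
  then show "f \<otimes>\<^bsub>BijGroup (rays n)\<^esub> g \<in> {f \<in> Bij (rays n). eventual_translation n f}"
    by (simp add: BijGroup_def compose_Bij eventual_translation_compose)
next
  show "\<one>\<^bsub>BijGroup (rays n)\<^esub> \<in> {f \<in> Bij (rays n). eventual_translation n f}"
    by (simp add: BijGroup_def id_Bij eventual_translation_id)
next
  fix f assume "f \<in> {f \<in> Bij (rays n). eventual_translation n f}"
  then show "inv\<^bsub>BijGroup (rays n)\<^esub> f \<in> {f \<in> Bij (rays n). eventual_translation n f}"
    by (simp add: inv_BijGroup restrict_inv_into_Bij eventual_translation_inv)
qed

lemma group_houghton: "group (houghton n)"
  unfolding houghton_def
  by (rule subgroup.subgroup_is_group[OF subgroup_houghton group_BijGroup])

end

theory Submission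
  imports Defs
begin

text \<open>
  Cut every ray into consecutive blocks of length \<open>m \<ge> 1\<close> and let a permutation \<open>f\<close> of the rays
  act on the blocks instead of on the points, keeping the position inside the block.  The result,
  \<open>inflate n m f\<close>, moves the tail of a ray by \<open>m * t\<close> if \<open>f\<close> moves it by \<open>t\<close>, so inflation is an
  injective endomorphism of the Houghton group.  Inflating by \<open>b\<close> and then by \<open>a\<close> is inflating by
  \<open>a * b\<close> (\<open>inflate_inflate\<close>); hence the \<open>k\<close>-th iterate of \<open>inflate n 2\<close> is \<open>inflate n (2 ^ k)\<close>.

  Suppose that \<open>g\<close> lies in the image of every iterate.  It preserves positions modulo \<open>2 ^ k\<close>
  for all \<open>k\<close>, hence it preserves positions.  It also maps the first \<open>2 ^ k\<close> points of ray \<open>i\<close>,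
  which form one block, into a single ray; for large \<open>k\<close> this block reaches the part where \<open>g\<close> is
  a translation of ray \<open>i\<close> into itself, so the single ray is ray \<open>i\<close>.  Thus \<open>g\<close> is the identity,
  which makes the group dis-co-Hopfian.

  If every injective endomorphism of a group were surjective, the iterated images of each would be
  the whole group, so a nontrivial dis-co-Hopfian group is not co-Hopfian
  (\<open>dis_co_hopfian_not_co_hopfian\<close>).  For \<open>n \<ge> 1\<close> the Houghton group is nontrivial, as it contains
  the transposition of the first two points of ray 1.
\<close>

section \<open>Dis-co-Hopfian groups\<close>

lemma dis_co_hopfian_not_co_hopfian:
  assumes dis: "dis_co_hopfian G" and nontrivial: "carrier G \<noteq> {\<one>\<^bsub>G\<^esub>}"
  shows "\<not> co_hopfian G"
proof
  assume "co_hopfian G"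
  obtain \<eta> where \<eta>: "\<eta> \<in> mon G G" and trivial: "(\<Inter>k\<in>{1..}. (\<eta> ^^ k) ` carrier G) = {\<one>\<^bsub>G\<^esub>}"
    using dis unfolding dis_co_hopfian_def by blast
  have surj: "\<eta> ` carrier G = carrier G"
    using \<open>co_hopfian G\<close> \<eta> unfolding co_hopfian_def by blast
  have "(\<eta> ^^ k) ` carrier G = carrier G" for k
    proof (induction k)
    case (Suc k)
    have "(\<eta> ^^ Suc k) ` carrier G = \<eta> ` (\<eta> ^^ k) ` carrier G"
      by (simp add: image_comp)
    then show ?case
      by (simp only: Suc.IH surj)
  qed simp
  then have "(\<Inter>k\<in>{1..}. (\<eta> ^^ k) ` carrier G) = carrier G"
    by auto
  with trivial nontrivial show False by simp
qed

section \<open>Inflation of permutations of the rays\<close>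

definition inflate :: "nat \<Rightarrow> nat \<Rightarrow> (nat \<times> nat \<Rightarrow> nat \<times> nat) \<Rightarrow> nat \<times> nat \<Rightarrow> nat \<times> nat" where
  "inflate n m f = (\<lambda>p\<in>rays n. let q = f (fst p, snd p div m) in (fst q, m * snd q + snd p mod m))"

lemma inflate_apply:
  "i \<in> {1..n} \<Longrightarrow>
    inflate n m f (i, x) = (fst (f (i, x div m)), m * snd (f (i, x div m)) + x mod m)"
  by (simp add: inflate_def rays_def Let_def)

lemma fst_in_index:
  assumes "f \<in> rays n \<rightarrow> rays n" "i \<in> {1..n}"
  shows "fst (f (i, x)) \<in> {1..n}"
  using funcset_mem[OF assms(1), of "(i, x)"] assms(2) by (auto simp: rays_def)

lemma eq_on_rays:
  assumes "f \<in> extensional (rays n)" "g \<in> extensional (rays n)"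
    and "\<And>i x. i \<in> {1..n} \<Longrightarrow> f (i, x) = g (i, x)"
  shows "f = g"
  using assms by (intro extensionalityI[of f "rays n" g]) (auto simp: rays_def)

lemma inflate_extensional: "inflate n m f \<in> extensional (rays n)"
  by (simp add: inflate_def)

lemma inflate_funcset:
  assumes "f \<in> rays n \<rightarrow> rays n"
  shows "inflate n m f \<in> rays n \<rightarrow> rays n"
  using fst_in_index[OF assms] by (auto simp: rays_def inflate_apply)

text \<open>The two remainders fit together by the mixed-radix expansion
  \<open>x mod (a * b) = a * (x div a mod b) + x mod a\<close>.\<close>

lemma inflate_inflate: "inflate n a (inflate n b f) = inflate n (a * b) f"
proof (rule eq_on_rays)
  fix i x assume "i \<in> {1..n}"
  then show "inflate n a (inflate n b f) (i, x) = inflate n (a * b) f (i, x)"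
    by (simp add: inflate_apply div_mult2_eq mod_mult2_eq algebra_simps)
qed (simp_all add: inflate_extensional)

lemma inflate_1:
  assumes "f \<in> extensional (rays n)"
  shows "inflate n 1 f = f"
proof (rule eq_on_rays)
  fix i x assume "i \<in> {1..n}"
  then show "inflate n 1 f (i, x) = f (i, x)"
    by (simp add: inflate_apply)
qed (simp_all add: assms inflate_extensional)

lemma funpow_inflate:
  assumes "f \<in> extensional (rays n)"
  shows "(inflate n m ^^ k) f = inflate n (m ^ k) f"
proof (induction k)
  case 0
  show ?case using inflate_1[OF assms] by simp
qed (simp add: inflate_inflate)

lemma inflate_compose:
  assumes "m > 0" "g \<in> rays n \<rightarrow> rays n"
  shows "inflate n m (compose (rays n) f g) = compose (rays n) (inflate n m f) (inflate n m g)"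
proof (rule eq_on_rays)
  fix i x assume i: "i \<in> {1..n}"
  have "fst (g (i, x div m)) \<in> {1..n}"
    using fst_in_index[OF assms(2) i] .
  then show "inflate n m (compose (rays n) f g) (i, x)
      = compose (rays n) (inflate n m f) (inflate n m g) (i, x)"
    using i \<open>m > 0\<close> by (simp add: inflate_apply compose_def rays_def)
qed (simp_all add: inflate_extensional)

lemma inflate_id: "inflate n m (\<lambda>p\<in>rays n. p) = (\<lambda>p\<in>rays n. p)"
proof (rule eq_on_rays)
  fix i x assume "i \<in> {1..n}"
  then show "inflate n m (\<lambda>p\<in>rays n. p) (i, x) = (\<lambda>p\<in>rays n. p) (i, x)"
    by (simp add: inflate_apply) (simp add: rays_def)
qed (simp_all add: inflate_extensional)

text \<open>Inflation preserves composition and the identity, so inflating the inverse of \<open>f\<close> gives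
  a two-sided inverse of the inflation of \<open>f\<close>.\<close>

lemma inflate_Bij:
  assumes "m > 0" and f: "f \<in> Bij (rays n)"
  shows "inflate n m f \<in> Bij (rays n)"
proof -
  define f' where "f' = (\<lambda>p\<in>rays n. inv_into (rays n) f p)"
  have bij: "bij_betw f (rays n) (rays n)"
    using f by (simp add: Bij_def)
  have f': "f' \<in> Bij (rays n)"
    unfolding f'_def by (rule restrict_inv_into_Bij[OF f])
  have maps: "f \<in> rays n \<rightarrow> rays n" "f' \<in> rays n \<rightarrow> rays n"
    using Bij_imp_funcset[OF f] Bij_imp_funcset[OF f'] by simp_all
  have "compose (rays n) f' f = (\<lambda>p\<in>rays n. p)"
    unfolding f'_def by (rule compose_inv_into_id[OF bij])
  then have left: "compose (rays n) (inflate n m f') (inflate n m f) = (\<lambda>p\<in>rays n. p)"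
    using inflate_compose[OF \<open>m > 0\<close> maps(1), of f'] by (simp add: inflate_id)
  have "compose (rays n) f f' = (\<lambda>p\<in>rays n. p)"
    unfolding f'_def using bij by (intro compose_id_inv_into) (simp add: bij_betw_def)
  then have right: "compose (rays n) (inflate n m f) (inflate n m f') = (\<lambda>p\<in>rays n. p)"
    using inflate_compose[OF \<open>m > 0\<close> maps(2), of f] by (simp add: inflate_id)
  have "bij_betw (inflate n m f) (rays n) (rays n)"
  proof (rule bij_betwI[where g = "inflate n m f'"])
    fix p assume p: "p \<in> rays n"
    show "inflate n m f' (inflate n m f p) = p"
      using fun_cong[OF left, of p] p by (simp add: compose_eq)
    show "inflate n m f (inflate n m f' p) = p"
      using fun_cong[OF right, of p] p by (simp add: compose_eq)
  qed (use maps inflate_funcset in auto)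
  then show ?thesis
    by (simp add: Bij_def inflate_extensional)
qed

lemma eventual_translation_inflate:
  assumes "m > 0" and f: "eventual_translation n f"
  shows "eventual_translation n (inflate n m f)"
  unfolding eventual_translation_def cofinite_eq_sequentially eventually_sequentially
proof
  fix i assume i: "i \<in> {1..n}"
  obtain t N where N: "\<And>x. x \<ge> N \<Longrightarrow> fst (f (i, x)) = i \<and> int (snd (f (i, x))) = int x + t"
    using f i unfolding eventual_translation_def cofinite_eq_sequentially eventually_sequentially
    by meson
  have "fst (inflate n m f (i, x)) = i \<and> int (snd (inflate n m f (i, x))) = int x + int m * t"
    if x: "x \<ge> m * N" for x
  proof -
    have "x div m \<ge> N"
      using x \<open>m > 0\<close> by (simp add: less_eq_div_iff_mult_less_eq mult.commute)
    note * = N[OF this]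
    have "int (snd (inflate n m f (i, x)))
        = int m * int (snd (f (i, x div m))) + int (x mod m)"
      using i by (simp add: inflate_apply)
    also have "\<dots> = int (m * (x div m) + x mod m) + int m * t"
      using * by (simp only: of_nat_add of_nat_mult distrib_left)
    finally show ?thesis
      using * i by (simp add: inflate_apply)
  qed
  then show "\<exists>u N. \<forall>x\<ge>N. fst (inflate n m f (i, x)) = i \<and>
      int (snd (inflate n m f (i, x))) = int x + u"
    by blast
qed

text \<open>The values of \<open>f\<close> are read off from those of its inflation at the starting points of the
  blocks.\<close>

lemma inflate_inject:
  assumes "m > 0" "f \<in> extensional (rays n)" "g \<in> extensional (rays n)"
    and eq: "inflate n m f = inflate n m g"
  shows "f = g"
proof (rule eq_on_rays)
  fix i x assume i: "i \<in> {1..n}"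
  then show "f (i, x) = g (i, x)"
    using fun_cong[OF eq, of "(i, m * x)"] \<open>m > 0\<close> by (simp add: inflate_apply prod_eq_iff)
qed (use assms in auto)

section \<open>Inflation as an endomorphism of the Houghton group\<close>

lemma carrier_houghton: "carrier (houghton n) = {f \<in> Bij (rays n). eventual_translation n f}"
  by (simp add: houghton_def)

lemma one_houghton: "\<one>\<^bsub>houghton n\<^esub> = (\<lambda>p\<in>rays n. p)"
  by (simp add: houghton_def BijGroup_def)

lemma mult_houghton:
  assumes "f \<in> Bij (rays n)" "g \<in> Bij (rays n)"
  shows "f \<otimes>\<^bsub>houghton n\<^esub> g = compose (rays n) f g"
  using assms by (simp add: houghton_def BijGroup_def)

lemma inflate_mon:
  assumes "m > 0"
  shows "inflate n m \<in> mon (houghton n) (houghton n)"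
proof -
  have "inflate n m \<in> hom (houghton n) (houghton n)"
    using assms
    by (auto intro!: homI simp: carrier_houghton mult_houghton inflate_Bij
        eventual_translation_inflate inflate_compose Bij_imp_funcset)
  moreover have "inj_on (inflate n m) (carrier (houghton n))"
    by (rule inj_onI, rule inflate_inject[OF assms])
      (simp_all add: carrier_houghton Bij_def)
  ultimately show ?thesis
    by (simp add: mon_def)
qed

text \<open>The inflations by \<open>m ^ k\<close> preserve positions modulo \<open>m ^ k\<close> and never tear a block apart;
  the first property fixes positions, the second fixes rays, because every point shares a block with
  some point whose ray is known to be preserved.\<close>

lemma eventual_translation_all_inflations_eq_id:
  assumes g: "eventual_translation n g" "g \<in> extensional (rays n)" and "m > 1"
    and infl: "\<And>k. k \<ge> 1 \<Longrightarrow> \<exists>f. g = inflate n (m ^ k) f"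
  shows "g = (\<lambda>p\<in>rays n. p)"
proof (rule eq_on_rays)
  fix i x assume i: "i \<in> {1..n}"
  obtain t N where N: "\<And>z. z \<ge> N \<Longrightarrow> fst (g (i, z)) = i \<and> int (snd (g (i, z))) = int z + t"
    using g i unfolding eventual_translation_def cofinite_eq_sequentially eventually_sequentially
    by meson
  \<comment> \<open>Choose a block size so large that \<open>x\<close>, its image and a point of the translated tail all lie in
    first blocks.\<close>
  define k where "k = Suc (x + N + snd (g (i, x)))"
  have "k < m ^ k"
    using \<open>m > 1\<close> by (simp add: power_gt_expt)
  then have bounds: "x < m ^ k" "N < m ^ k" "snd (g (i, x)) < m ^ k"
    by (auto simp: k_def)
  obtain f where f: "g = inflate n (m ^ k) f"
    using infl[of k] by (auto simp: k_def)
  have "fst (g (i, x)) = fst (f (i, 0))" "fst (g (i, N)) = fst (f (i, 0))"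
    using i bounds(1,2) by (simp_all add: f inflate_apply)
  then have ray: "fst (g (i, x)) = i"
    using N[of N] by simp
  have "snd (g (i, x)) = m ^ k * snd (f (i, 0)) + x"
    using i bounds(1) by (simp add: f inflate_apply)
  then have "snd (g (i, x)) mod m ^ k = x"
    using bounds(1) by simp
  then have "snd (g (i, x)) = x"
    using bounds(3) by simp
  with ray show "g (i, x) = (\<lambda>p\<in>rays n. p) (i, x)"
    using i by (simp add: rays_def prod_eq_iff)
qed (use g in auto)

lemma dis_co_hopfian_houghton: "dis_co_hopfian (houghton n)"
  unfolding dis_co_hopfian_def
proof (rule bexI)
  let ?\<eta> = "inflate n 2" and ?H = "carrier (houghton n)"
  show mon: "?\<eta> \<in> mon (houghton n) (houghton n)"
    by (simp add: inflate_mon)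
  have iterate: "(?\<eta> ^^ k) f = inflate n (2 ^ k) f" if "f \<in> ?H" for k f
    using that by (intro funpow_inflate) (simp add: carrier_houghton Bij_def)
  show "(\<Inter>k\<in>{1..}. (?\<eta> ^^ k) ` ?H) = {\<one>\<^bsub>houghton n\<^esub>}"
  proof (intro equalityI subsetI)
    fix g assume g: "g \<in> (\<Inter>k\<in>{1..}. (?\<eta> ^^ k) ` ?H)"
    have "g \<in> ?\<eta> ` ?H"
      using INT_D[OF g, of 1] by simp
    then have "g \<in> ?H"
      using mon by (auto simp: mon_def hom_def)
    have "\<exists>f. g = inflate n (2 ^ k) f" if "k \<ge> 1" for k
      using INT_D[OF g, of k] that iterate by auto
    then have "g = (\<lambda>p\<in>rays n. p)"
      using \<open>g \<in> ?H\<close>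
      by (intro eventual_translation_all_inflations_eq_id[where m = 2])
        (auto simp: carrier_houghton Bij_def)
    then show "g \<in> {\<one>\<^bsub>houghton n\<^esub>}"
      by (simp add: one_houghton)
  next
    fix g assume "g \<in> {\<one>\<^bsub>houghton n\<^esub>}"
    then have g: "g = (\<lambda>p\<in>rays n. p)"
      by (simp add: one_houghton)
    then have "g \<in> ?H"
      by (simp add: carrier_houghton id_Bij eventual_translation_id)
    moreover have "(?\<eta> ^^ k) g = g" for k
      using iterate[OF \<open>g \<in> ?H\<close>] by (simp add: g inflate_id)
    ultimately show "g \<in> (\<Inter>k\<in>{1..}. (?\<eta> ^^ k) ` ?H)"
      by (metis INT_I image_eqI)
  qed
qed

lemma houghton_nontrivial:
  assumes "n \<ge> 1"
  shows "carrier (houghton n) \<noteq> {\<one>\<^bsub>houghton n\<^esub>}"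
proof -
  define s where "s = (\<lambda>p\<in>rays n. transpose (1, 0) (1, 1) p)"
  have pts: "(1, 0) \<in> rays n" "(1, 1) \<in> rays n"
    using assms by (auto simp: rays_def)
  have "bij_betw s (rays n) (rays n)"
    unfolding s_def bij_betw_restrict_eq
    using pts by (intro bij_betwI[where g = "transpose (1, 0) (1, 1)"]) (auto simp: transpose_def)
  then have "s \<in> Bij (rays n)"
    by (simp add: Bij_def s_def)
  moreover have "eventual_translation n s"
    unfolding eventual_translation_def cofinite_eq_sequentially eventually_sequentially
  proof (intro ballI exI allI impI)
    fix i x :: nat assume "i \<in> {1..n}" "2 \<le> x"
    then show "fst (s (i, x)) = i \<and> int (snd (s (i, x))) = int x + 0"
      by (simp add: s_def rays_def transpose_def)
  qed
  ultimately have "s \<in> carrier (houghton n)"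
    by (simp add: carrier_houghton)
  moreover have "s (1, 0) \<noteq> (\<lambda>p\<in>rays n. p) (1, 0)"
    using pts by (simp add: s_def)
  ultimately show ?thesis
    by (auto simp: one_houghton)
qed

theorem proposition5p5:
  fixes n :: nat
  assumes "n \<ge> 1"
  shows "\<not> co_hopfian (houghton n) \<and> dis_co_hopfian (houghton n)"
  using dis_co_hopfian_not_co_hopfian[OF dis_co_hopfian_houghton houghton_nontrivial[OF assms]]
    dis_co_hopfian_houghton by blast

end
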